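(* Let $\mathcal{C}$ be the set of linear-Gaussian symbolic states, i.e. the symbolic states $g$ such that (a) every distribution $g(X)$ is Gaussian with constant variance (the variance expression does not depend on any random variable), and (b) the mean of each Gaussian distribution $g(X)$ is an affine function of other random variables. Then $\mathcal{C}$ is a closed family.
   Context: **Expressions and states.** Fix a set $\mathcal{V}$ of random variable names. Symbolic expressions are $E ::= \mathtt{app}(op,E,\dots,E)\mid r\mid c\mid X$ with $r\in\mathbb{R}$, $c\in\mathbb{Z}$, $X\in\mathcal{V}$ and $op$ one of $+,-,*,/,\mathtt{sqrt},\mathtt{ite},=,\neq,<,\le$. Symbolic distributions are $\mathcal{N}(E,E)$ (mean, variance), $\mathrm{Bernoulli}(E)$, $\beta(E,E)$, $\delta(E)$. We write $e_1+e_2$, $e_1-e_2$, $e_1*e_2$, $\frac{e_1}{e_2}$, $\mathtt{ite}(e_1,e_2,e_3)$ for the corresponding symbolic terms (these are term constructors; no arithmetic is performed), and $e_1[X\leftarrow e_2]$ for substitution. A symbolic state $g$ is a finite map from $\mathcal{V}$ to symbolic distributions; $Y$ is a parent of $X$ in $g$ if $Y$ occurs in $g(X)$; $\mathrm{pa}(X)$ is the set of parents. All symbolic states are acyclic for the parent relation and every parent lies in the domain of $g$. $g[X\mapsto d]$ denotes update. **Swap.** $\mathrm{SWAP}(X_1,X_2,g)$, applied when $X_1$ is a parent of $X_2$, returns a pair (state, Boolean): 1. If $g(X_1)=\mathcal{N}(\mu_0,v_0)$, $g(X_2)=\mathcal{N}(\mu,v)$, $\mathrm{AFFINE}(\mu,X_1)=(a,b)$,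 and $v_0,v$ contain no random variables: put $\mu_0'=(a*\mu_0)+b$, $v_0'=(a*a)*v_0$, $v_0''=\frac{1}{\frac1{v_0'}+\frac1v}$, $\mu_0''=\left(\frac{\mu_0'}{v_0'}+\frac{X_2}{v}\right)*v_0''$, and return $\left(g\left[X_1\mapsto\mathcal{N}\left(\frac{\mu_0''-b}{a},\frac{v_0''}{a*a}\right)\right]\left[X_2\mapsto\mathcal{N}(\mu_0',v_0'+v)\right],\mathbf{true}\right)$. 2. If $g(X_1)=\beta(a,b)$, $g(X_2)=\mathrm{Bernoulli}(X_1)$: return $\left(g\left[X_1\mapsto\beta(a+\mathtt{ite}(X_2,1,0),\,b+\mathtt{ite}(X_2,0,1))\right]\left[X_2\mapsto\mathrm{Bernoulli}\left(\frac{a}{a+b}\right)\right],\mathbf{true}\right)$. 3. If $g(X_1)=\mathrm{Bernoulli}(p_1)$, $g(X_2)=\mathrm{Bernoulli}(p_2)$: put $p_2'=(p_1*p_2[X_1\leftarrow1])+((1-p_1)*p_2[X_1\leftarrow0])$ and $p_1'=\frac{p_1*\left(\mathtt{ite}(X_2,p_2,1-p_2)[X_1\leftarrow1]\right)}{\mathtt{ite}(X_2,p_2',1-p_2')}$, and return $(g[X_1\mapsto\mathrm{Bernoulli}(p_1')][X_2\mapsto\mathrm{Bernoulli}(p_2')],\mathbf{true})$. 4. Otherwise return $(g,\mathbf{false})$. **Affine analysis.** $\mathrm{AFFINE}(\mu,X_1)=(a,b)$ means that $\mu$ can be written as $a*X_1+b$ with $a,b$ symbolic expressions not containing $X_1$.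 Here "affine function of random variables" refers to the expressions built recursively from random-variable-free expressions and random variables by $+$, $-$, multiplication by a random-variable-free expression, and division by a random-variable-free expression. The analysis is recursive and precise enough that for every such $\mu$, $\mathrm{AFFINE}(\mu,X_1)$ succeeds and returns $(a,b)$ with $a$ random-variable-free and $b$ again such an affine expression, whose random variables are among those of $\mu$ other than $X_1$. **Legal swaps.** $\mathrm{CAN\_SWAP}(X_1,X_2,g)$ is true iff swapping creates no dependency cycle, i.e. iff the graph obtained from the parent graph of $g$ by giving $X_2$ the parents $(\mathrm{pa}(X_1)\cup\mathrm{pa}(X_2))\setminus\{X_1\}$ and $X_1$ the parents $(\mathrm{pa}(X_1)\cup\mathrm{pa}(X_2)\cup\{X_2\})\setminus\{X_1\}$ (other variables unchanged) is acyclic. **Closed family.** A closed family is a set $\mathcal{C}$ of symbolic states such that whenever $g\in\mathcal{C}$ and $X_1,X_2$ in the domain of $g$, with $X_1$ a parent of $X_2$, satisfy $\mathrm{CAN\_SWAP}(X_1,X_2,g)$, then $\mathrm{SWAP}(X_1,X_2,g)=(g',\mathbf{true})$ with $g'\in\mathcal{C}$. *)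

theory Defs
  imports Complex_Main "HOL-Library.Finite_Map"
begin

text \<open>
  The set of random variable names is the type variable \<open>'v\<close>.  The automatically generated set
  functions \<open>expr_vars\<close> and \<open>dist_vars\<close> give the random variables occurring in an expression or
  a distribution.
\<close>

datatype oper = Add | Sub | Mul | Div | Sqrt | Ite | Eq | Neq | Less | LessEq

datatype (expr_vars: 'v) expr =
    App oper "'v expr list"
  | RealC real
  | IntC int
  | Var 'v

text \<open>The second argument of \<open>Normal\<close> is the variance.\<close>

datatype (dist_vars: 'v) dist =
    Normal "'v expr" "'v expr"
  | Bernoulli "'v expr"
  | Beta "'v expr" "'v expr"
  | Delta "'v expr"

abbreviation add_expr :: "'v expr \<Rightarrow> 'v expr \<Rightarrow> 'v expr" (infixl "+\<^sub>e" 65)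
  where "e1 +\<^sub>e e2 \<equiv> App Add [e1, e2]"

abbreviation sub_expr :: "'v expr \<Rightarrow> 'v expr \<Rightarrow> 'v expr" (infixl "-\<^sub>e" 65)
  where "e1 -\<^sub>e e2 \<equiv> App Sub [e1, e2]"

abbreviation mul_expr :: "'v expr \<Rightarrow> 'v expr \<Rightarrow> 'v expr" (infixl "*\<^sub>e" 70)
  where "e1 *\<^sub>e e2 \<equiv> App Mul [e1, e2]"

abbreviation div_expr :: "'v expr \<Rightarrow> 'v expr \<Rightarrow> 'v expr" (infixl "'/\<^sub>e" 70)
  where "e1 /\<^sub>e e2 \<equiv> App Div [e1, e2]"

abbreviation ite_expr :: "'v expr \<Rightarrow> 'v expr \<Rightarrow> 'v expr \<Rightarrow> 'v expr"
  where "ite_expr e1 e2 e3 \<equiv> App Ite [e1, e2, e3]"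

abbreviation rv_free :: "'v expr \<Rightarrow> bool"
  where "rv_free e \<equiv> expr_vars e = {}"

primrec subst :: "'v \<Rightarrow> 'v expr \<Rightarrow> 'v expr \<Rightarrow> 'v expr" where
  "subst X e (App f es) = App f (map (subst X e) es)"
| "subst X e (RealC r) = RealC r"
| "subst X e (IntC c) = IntC c"
| "subst X e (Var Y) = (if Y = X then e else Var Y)"

text \<open>
  The value of an expression under an assignment of reals to the random variables.  Truth values
  are the numbers 0 and 1.  Division by zero, the square root of a negative number and an
  application with the wrong number of arguments have no value; \<open>Ite\<close> only needs the selected
  branch to have one.
\<close>

fun eval_app :: "oper \<Rightarrow> real option list \<Rightarrow> real option" where
  "eval_app Add [Some x, Some y] = Some (x + y)"
| "eval_app Sub [Some x, Some y] = Some (x - y)"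
| "eval_app Mul [Some x, Some y] = Some (x * y)"
| "eval_app Div [Some x, Some y] = (if y = 0 then None else Some (x / y))"
| "eval_app Sqrt [Some x] = (if x < 0 then None else Some (sqrt x))"
| "eval_app Ite [Some x, y, z] = (if x \<noteq> 0 then y else z)"
| "eval_app Eq [Some x, Some y] = Some (of_bool (x = y))"
| "eval_app Neq [Some x, Some y] = Some (of_bool (x \<noteq> y))"
| "eval_app Less [Some x, Some y] = Some (of_bool (x < y))"
| "eval_app LessEq [Some x, Some y] = Some (of_bool (x \<le> y))"
| "eval_app _ _ = None"

primrec eval :: "('v \<Rightarrow> real) \<Rightarrow> 'v expr \<Rightarrow> real option" where
  "eval \<sigma> (App f es) = eval_app f (map (eval \<sigma>) es)"
| "eval \<sigma> (RealC r) = Some r"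
| "eval \<sigma> (IntC c) = Some (of_int c)"
| "eval \<sigma> (Var X) = Some (\<sigma> X)"

type_synonym 'v state = "('v, 'v dist) fmap"

definition parents :: "'v state \<Rightarrow> 'v \<Rightarrow> 'v set" where
  "parents g X = (case fmlookup g X of None \<Rightarrow> {} | Some d \<Rightarrow> dist_vars d)"

definition acyclic_parents :: "('v \<Rightarrow> 'v set) \<Rightarrow> bool" where
  "acyclic_parents pa \<longleftrightarrow> acyclic {(Y, X). Y \<in> pa X}"

text \<open>
  The type \<open>'v state\<close> only says that a state is a finite map; the standing assumptions on
  symbolic states are collected here.
\<close>

definition symbolic_state :: "'v state \<Rightarrow> bool" where
  "symbolic_state g \<longleftrightarrow>
     acyclic_parents (parents g) \<and> (\<forall>X \<in> fmdom' g. parents g X \<subseteq> fmdom' g)"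

inductive affine_expr :: "'v expr \<Rightarrow> bool" where
  const: "rv_free e \<Longrightarrow> affine_expr e"
| var: "affine_expr (Var X)"
| add: "affine_expr e1 \<Longrightarrow> affine_expr e2 \<Longrightarrow> affine_expr (e1 +\<^sub>e e2)"
| sub: "affine_expr e1 \<Longrightarrow> affine_expr e2 \<Longrightarrow> affine_expr (e1 -\<^sub>e e2)"
| mul_left: "rv_free c \<Longrightarrow> affine_expr e \<Longrightarrow> affine_expr (c *\<^sub>e e)"
| mul_right: "affine_expr e \<Longrightarrow> rv_free c \<Longrightarrow> affine_expr (e *\<^sub>e c)"
| div: "affine_expr e \<Longrightarrow> rv_free c \<Longrightarrow> affine_expr (e /\<^sub>e c)"

text \<open>
  The affine analysis is not fixed to one particular algorithm: it is any partial function
  (\<open>None\<close> for failure) with the two properties below.  The first says what a result \<open>(a, b)\<close>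
  means, namely that \<open>\<mu>\<close> can be written as \<open>a *\<^sub>e Var X +\<^sub>e b\<close>; the equality is one of values, since
  the two terms are in general different.  The second is the precision of the analysis on affine
  expressions.
\<close>

type_synonym 'v analysis = "'v expr \<Rightarrow> 'v \<Rightarrow> ('v expr \<times> 'v expr) option"

definition affine_analysis :: "'v analysis \<Rightarrow> bool" where
  "affine_analysis AFFINE \<longleftrightarrow>
     (\<forall>\<mu> X a b. AFFINE \<mu> X = Some (a, b) \<longrightarrow>
        X \<notin> expr_vars a \<and> X \<notin> expr_vars b \<and>
        (\<forall>\<sigma> r. eval \<sigma> \<mu> = Some r \<longrightarrow> eval \<sigma> (a *\<^sub>e Var X +\<^sub>e b) = Some r)) \<and>
     (\<forall>\<mu> X. affine_expr \<mu> \<longrightarrow>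
        (\<exists>a b. AFFINE \<mu> X = Some (a, b) \<and> rv_free a \<and> affine_expr b \<and>
               expr_vars b \<subseteq> expr_vars \<mu> - {X}))"

definition swap :: "'v analysis \<Rightarrow> 'v \<Rightarrow> 'v \<Rightarrow> 'v state \<Rightarrow> 'v state \<times> bool" where
  "swap AFFINE X1 X2 g =
     (case (fmlookup g X1, fmlookup g X2) of
        (Some (Normal \<mu>0 v0), Some (Normal \<mu> v)) \<Rightarrow>
          (case AFFINE \<mu> X1 of
             Some (a, b) \<Rightarrow>
               if rv_free v0 \<and> rv_free v then
                 let \<mu>0' = (a *\<^sub>e \<mu>0) +\<^sub>e b;
                     v0' = (a *\<^sub>e a) *\<^sub>e v0;
                     v0'' = IntC 1 /\<^sub>e ((IntC 1 /\<^sub>e v0') +\<^sub>e (IntC 1 /\<^sub>e v));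
                     \<mu>0'' = ((\<mu>0' /\<^sub>e v0') +\<^sub>e (Var X2 /\<^sub>e v)) *\<^sub>e v0''
                 in (fmupd X2 (Normal \<mu>0' (v0' +\<^sub>e v))
                      (fmupd X1 (Normal ((\<mu>0'' -\<^sub>e b) /\<^sub>e a) (v0'' /\<^sub>e (a *\<^sub>e a))) g), True)
               else (g, False)
           | None \<Rightarrow> (g, False))
      | (Some (Beta a b), Some (Bernoulli p)) \<Rightarrow>
          if p = Var X1 then
            (fmupd X2 (Bernoulli (a /\<^sub>e (a +\<^sub>e b)))
              (fmupd X1 (Beta (a +\<^sub>e ite_expr (Var X2) (IntC 1) (IntC 0))
                              (b +\<^sub>e ite_expr (Var X2) (IntC 0) (IntC 1))) g), True)
          else (g, False)
      | (Some (Bernoulli p1), Some (Bernoulli p2)) \<Rightarrow>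
          let p2' = (p1 *\<^sub>e subst X1 (IntC 1) p2) +\<^sub>e ((IntC 1 -\<^sub>e p1) *\<^sub>e subst X1 (IntC 0) p2);
              p1' = (p1 *\<^sub>e subst X1 (IntC 1) (ite_expr (Var X2) p2 (IntC 1 -\<^sub>e p2)))
                    /\<^sub>e ite_expr (Var X2) p2' (IntC 1 -\<^sub>e p2')
          in (fmupd X2 (Bernoulli p2') (fmupd X1 (Bernoulli p1') g), True)
      | _ \<Rightarrow> (g, False))"

definition can_swap :: "'v \<Rightarrow> 'v \<Rightarrow> 'v state \<Rightarrow> bool" where
  "can_swap X1 X2 g \<longleftrightarrow>
     acyclic_parents
       ((parents g)
          (X2 := (parents g X1 \<union> parents g X2) - {X1},
           X1 := (parents g X1 \<union> parents g X2 \<union> {X2}) - {X1}))"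

definition closed_family :: "'v analysis \<Rightarrow> 'v state set \<Rightarrow> bool" where
  "closed_family AFFINE C \<longleftrightarrow>
     C \<subseteq> Collect symbolic_state \<and>
     (\<forall>g \<in> C. \<forall>X1 \<in> fmdom' g. \<forall>X2 \<in> fmdom' g.
        X1 \<in> parents g X2 \<longrightarrow> can_swap X1 X2 g \<longrightarrow>
        (\<exists>g' \<in> C. swap AFFINE X1 X2 g = (g', True)))"

definition linear_gaussian_states :: "'v state set" where
  "linear_gaussian_states =
     {g. symbolic_state g \<and>
         (\<forall>X \<in> fmdom' g. \<exists>\<mu> v. fmlookup g X = Some (Normal \<mu> v) \<and> rv_free v \<and>
            affine_expr \<mu> \<and> X \<notin> expr_vars \<mu>)}"

text \<open>The two properties required of an affine analysis are consistent.\<close>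

lemma affine_expr_decompose:
  assumes "affine_expr \<mu>"
  shows "\<exists>a b. rv_free a \<and> affine_expr b \<and> expr_vars b \<subseteq> expr_vars \<mu> - {X} \<and>
               (\<forall>\<sigma> r. eval \<sigma> \<mu> = Some r \<longrightarrow> eval \<sigma> (a *\<^sub>e Var X +\<^sub>e b) = Some r)"
  using assms
proof induction
  case (const e)
  have "eval \<sigma> (IntC 0 *\<^sub>e Var X +\<^sub>e e) = Some r" if "eval \<sigma> e = Some r" for \<sigma> r
    using that by simp
  then show ?case
    using const by (intro exI[of _ "IntC 0"] exI[of _ e]) (auto intro: affine_expr.const)
next
  case (var Y)
  show ?case
  proof (cases "Y = X")
    case True
    then show ?thesis
      by (intro exI[of _ "IntC 1"] exI[of _ "IntC 0"]) (auto intro: affine_expr.const)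
  next
    case False
    then show ?thesis
      by (intro exI[of _ "IntC 0"] exI[of _ "Var Y"]) (auto intro: affine_expr.var)
  qed
next
  case (add e1 e2)
  then obtain a1 b1 a2 b2 where
    IH: "rv_free a1" "affine_expr b1" "expr_vars b1 \<subseteq> expr_vars e1 - {X}"
        "rv_free a2" "affine_expr b2" "expr_vars b2 \<subseteq> expr_vars e2 - {X}"
    and ev: "\<And>\<sigma> r. eval \<sigma> e1 = Some r \<Longrightarrow> eval \<sigma> (a1 *\<^sub>e Var X +\<^sub>e b1) = Some r"
        "\<And>\<sigma> r. eval \<sigma> e2 = Some r \<Longrightarrow> eval \<sigma> (a2 *\<^sub>e Var X +\<^sub>e b2) = Some r"
    by metis
  have "eval \<sigma> ((a1 +\<^sub>e a2) *\<^sub>e Var X +\<^sub>e (b1 +\<^sub>e b2)) = Some r"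
    if "eval \<sigma> (e1 +\<^sub>e e2) = Some r" for \<sigma> r
    using that ev[of \<sigma>]
    by (cases "eval \<sigma> e1"; cases "eval \<sigma> e2"; cases "eval \<sigma> a1"; cases "eval \<sigma> a2";
        cases "eval \<sigma> b1"; cases "eval \<sigma> b2") (auto simp: algebra_simps)
  then show ?case
    using IH by (intro exI[of _ "a1 +\<^sub>e a2"] exI[of _ "b1 +\<^sub>e b2"]) (auto intro: affine_expr.add)
next
  case (sub e1 e2)
  then obtain a1 b1 a2 b2 where
    IH: "rv_free a1" "affine_expr b1" "expr_vars b1 \<subseteq> expr_vars e1 - {X}"
        "rv_free a2" "affine_expr b2" "expr_vars b2 \<subseteq> expr_vars e2 - {X}"
    and ev: "\<And>\<sigma> r. eval \<sigma> e1 = Some r \<Longrightarrow> eval \<sigma> (a1 *\<^sub>e Var X +\<^sub>e b1) = Some r"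
        "\<And>\<sigma> r. eval \<sigma> e2 = Some r \<Longrightarrow> eval \<sigma> (a2 *\<^sub>e Var X +\<^sub>e b2) = Some r"
    by metis
  have "eval \<sigma> ((a1 -\<^sub>e a2) *\<^sub>e Var X +\<^sub>e (b1 -\<^sub>e b2)) = Some r"
    if "eval \<sigma> (e1 -\<^sub>e e2) = Some r" for \<sigma> r
    using that ev[of \<sigma>]
    by (cases "eval \<sigma> e1"; cases "eval \<sigma> e2"; cases "eval \<sigma> a1"; cases "eval \<sigma> a2";
        cases "eval \<sigma> b1"; cases "eval \<sigma> b2") (auto simp: algebra_simps)
  then show ?case
    using IH by (intro exI[of _ "a1 -\<^sub>e a2"] exI[of _ "b1 -\<^sub>e b2"]) (auto intro: affine_expr.sub)
next
  case (mul_left c e)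
  then obtain a b where
    IH: "rv_free a" "affine_expr b" "expr_vars b \<subseteq> expr_vars e - {X}"
    and ev: "\<And>\<sigma> r. eval \<sigma> e = Some r \<Longrightarrow> eval \<sigma> (a *\<^sub>e Var X +\<^sub>e b) = Some r"
    by metis
  have "eval \<sigma> ((c *\<^sub>e a) *\<^sub>e Var X +\<^sub>e (c *\<^sub>e b)) = Some r"
    if "eval \<sigma> (c *\<^sub>e e) = Some r" for \<sigma> r
    using that ev[of \<sigma>]
    by (cases "eval \<sigma> e"; cases "eval \<sigma> c"; cases "eval \<sigma> a"; cases "eval \<sigma> b")
       (auto simp: algebra_simps)
  then show ?case
    using IH mul_left
    by (intro exI[of _ "c *\<^sub>e a"] exI[of _ "c *\<^sub>e b"]) (auto intro: affine_expr.mul_left)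
next
  case (mul_right e c)
  then obtain a b where
    IH: "rv_free a" "affine_expr b" "expr_vars b \<subseteq> expr_vars e - {X}"
    and ev: "\<And>\<sigma> r. eval \<sigma> e = Some r \<Longrightarrow> eval \<sigma> (a *\<^sub>e Var X +\<^sub>e b) = Some r"
    by metis
  have "eval \<sigma> ((a *\<^sub>e c) *\<^sub>e Var X +\<^sub>e (b *\<^sub>e c)) = Some r"
    if "eval \<sigma> (e *\<^sub>e c) = Some r" for \<sigma> r
    using that ev[of \<sigma>]
    by (cases "eval \<sigma> e"; cases "eval \<sigma> c"; cases "eval \<sigma> a"; cases "eval \<sigma> b")
       (auto simp: algebra_simps)
  then show ?case
    using IH mul_right
    by (intro exI[of _ "a *\<^sub>e c"] exI[of _ "b *\<^sub>e c"]) (auto intro: affine_expr.mul_right)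
next
  case (div e c)
  then obtain a b where
    IH: "rv_free a" "affine_expr b" "expr_vars b \<subseteq> expr_vars e - {X}"
    and ev: "\<And>\<sigma> r. eval \<sigma> e = Some r \<Longrightarrow> eval \<sigma> (a *\<^sub>e Var X +\<^sub>e b) = Some r"
    by metis
  have "eval \<sigma> ((a /\<^sub>e c) *\<^sub>e Var X +\<^sub>e (b /\<^sub>e c)) = Some r"
    if "eval \<sigma> (e /\<^sub>e c) = Some r" for \<sigma> r
    using that ev[of \<sigma>]
    by (cases "eval \<sigma> e"; cases "eval \<sigma> c"; cases "eval \<sigma> a"; cases "eval \<sigma> b")
       (auto simp: field_simps split: if_splits)
  then show ?case
    using IH div
    by (intro exI[of _ "a /\<^sub>e c"] exI[of _ "b /\<^sub>e c"]) (auto intro: affine_expr.div)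
qed

lemma affine_analysis_exists: "\<exists>AFFINE :: 'v analysis. affine_analysis AFFINE"
proof -
  define P :: "'v expr \<Rightarrow> 'v \<Rightarrow> 'v expr \<times> 'v expr \<Rightarrow> bool" where
    "P \<mu> X = (\<lambda>(a, b). rv_free a \<and> affine_expr b \<and> expr_vars b \<subseteq> expr_vars \<mu> - {X} \<and>
       (\<forall>\<sigma> r. eval \<sigma> \<mu> = Some r \<longrightarrow> eval \<sigma> (a *\<^sub>e Var X +\<^sub>e b) = Some r))" for \<mu> X
  define F :: "'v analysis" where
    "F \<mu> X = (if affine_expr \<mu> then Some (SOME ab. P \<mu> X ab) else None)" for \<mu> X
  have F: "P \<mu> X (SOME ab. P \<mu> X ab)" if "affine_expr \<mu>" for \<mu> X
    using affine_expr_decompose[OF that, of X] by (intro someI_ex[of "P \<mu> X"]) (auto simp: P_def)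
  have 1: "rv_free a" "affine_expr b" "expr_vars b \<subseteq> expr_vars \<mu> - {X}"
      and 2: "\<And>\<sigma> r. eval \<sigma> \<mu> = Some r \<Longrightarrow> eval \<sigma> (a *\<^sub>e Var X +\<^sub>e b) = Some r"
    if "F \<mu> X = Some (a, b)" for \<mu> X a b
  proof -
    have "P \<mu> X (a, b)"
      using that F[of \<mu> X] by (cases "affine_expr \<mu>") (simp_all add: F_def)
    then show "rv_free a" "affine_expr b" "expr_vars b \<subseteq> expr_vars \<mu> - {X}"
      and "\<And>\<sigma> r. eval \<sigma> \<mu> = Some r \<Longrightarrow> eval \<sigma> (a *\<^sub>e Var X +\<^sub>e b) = Some r"
      unfolding P_def by blast+
  qed
  have "affine_analysis F"
    unfolding affine_analysis_def
  proof (intro conjI allI impI)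
    fix \<mu> X a b
    assume ab: "F \<mu> X = Some (a, b)"
    show "X \<notin> expr_vars a" "X \<notin> expr_vars b"
      using 1[OF ab] by blast+
    show "eval \<sigma> (a *\<^sub>e Var X +\<^sub>e b) = Some r" if "eval \<sigma> \<mu> = Some r" for \<sigma> r
      using 2[OF ab that] .
  next
    fix \<mu> :: "'v expr" and X
    assume "affine_expr \<mu>"
    then obtain a b where ab: "F \<mu> X = Some (a, b)"
      by (cases "SOME ab. P \<mu> X ab") (simp add: F_def)
    with 1[OF ab] show "\<exists>a b. F \<mu> X = Some (a, b) \<and> rv_free a \<and> affine_expr b \<and>
        expr_vars b \<subseteq> expr_vars \<mu> - {X}"
      by blast
  qed
  then show ?thesis by blast
qed

end

theory Submission imports Defs begin

text \<open>
  Swapping in a linear-Gaussian state only combines the two means by sums, differences and scalings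
  with expressions free of random variables, so affinity is preserved.  The new parent sets are
  contained in those of the graph that \<open>can_swap\<close> requires to be acyclic, and acyclicity passes to
  subgraphs.
\<close>

lemma acyclic_parents_mono:
  assumes "acyclic_parents pa" "\<And>X. pa' X \<subseteq> pa X"
  shows "acyclic_parents pa'"
  using assms unfolding acyclic_parents_def by (blast intro: acyclic_subset)

lemma acyclic_parents_irrefl: "acyclic_parents pa \<Longrightarrow> X \<notin> pa X"
  unfolding acyclic_parents_def acyclic_def by blast

lemma parents_fmupd: "parents (fmupd X d g) = (parents g)(X := dist_vars d)"
  by (rule ext) (simp add: parents_def)

lemma parents_Normal:
  "fmlookup g X = Some (Normal \<mu> v) \<Longrightarrow> parents g X = expr_vars \<mu> \<union> expr_vars v"
  by (simp add: parents_def)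

lemma affine_analysisE:
  assumes "affine_analysis AFFINE" "affine_expr \<mu>"
  obtains a b where "AFFINE \<mu> X = Some (a, b)" "rv_free a" "affine_expr b"
    "expr_vars b \<subseteq> expr_vars \<mu> - {X}"
  using assms unfolding affine_analysis_def by meson

text \<open>The inclusion in \<open>fmdom' g\<close> comes from \<open>symbolic_state\<close>: with
  a variable-free variance, the parents of \<open>X\<close> are exactly the variables of its
  mean.\<close>

lemma linear_gaussian_statesE:
  assumes "g \<in> linear_gaussian_states" "X \<in> fmdom' g"
  obtains \<mu> v where "fmlookup g X = Some (Normal \<mu> v)" "rv_free v" "affine_expr \<mu>"
    "X \<notin> expr_vars \<mu>" "expr_vars \<mu> \<subseteq> fmdom' g"
proof -
  obtain \<mu> v where g: "fmlookup g X = Some (Normal \<mu> v)" "rv_free v" "affine_expr \<mu>"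
    "X \<notin> expr_vars \<mu>"
    using assms unfolding linear_gaussian_states_def by blast
  moreover have "parents g X \<subseteq> fmdom' g"
    using assms unfolding linear_gaussian_states_def symbolic_state_def by blast
  ultimately show thesis
    using that by (simp add: parents_Normal)
qed

text \<open>Reduces membership of a swapped state to conditions on the two new distributions. That
  neither mean mentions its own variable follows from acyclicity, which excludes self-loops.\<close>

lemma linear_gaussian_update2:
  assumes g: "g \<in> linear_gaussian_states"
    and X: "X1 \<in> fmdom' g" "X2 \<in> fmdom' g" "X1 \<noteq> X2"
    and rv_free: "rv_free v1" "rv_free v2"
    and affine: "affine_expr \<mu>1" "affine_expr \<mu>2"
    and dom: "expr_vars \<mu>1 \<subseteq> fmdom' g" "expr_vars \<mu>2 \<subseteq> fmdom' g"
    and acyclic: "acyclic_parents ((parents g)(X2 := expr_vars \<mu>2, X1 := expr_vars \<mu>1))"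
  shows "fmupd X2 (Normal \<mu>2 v2) (fmupd X1 (Normal \<mu>1 v1) g) \<in> linear_gaussian_states"
    (is "?g' \<in> _")
proof -
  have dom': "fmdom' ?g' = fmdom' g"
    using X by auto
  \<comment> \<open>The variances contribute no parents, and as \<open>X1\<close> and
    \<open>X2\<close> differ the updates can be reordered to the form used in
    \<open>can_swap\<close>.\<close>
  have pa: "parents ?g' = (parents g)(X2 := expr_vars \<mu>2, X1 := expr_vars \<mu>1)"
    using rv_free X by (simp add: parents_fmupd fun_upd_twist)
  have "X1 \<notin> expr_vars \<mu>1" "X2 \<notin> expr_vars \<mu>2"
    using acyclic_parents_irrefl[OF acyclic, of X1] acyclic_parents_irrefl[OF acyclic, of X2] X
    by auto
  moreover have "symbolic_state ?g'"
    using g dom acyclic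
    unfolding symbolic_state_def dom' pa linear_gaussian_states_def by auto
  ultimately show ?thesis
    using g rv_free affine unfolding linear_gaussian_states_def
    by (auto simp: dom' simp del: fmdom'_fmupd)
qed

theorem theorem5p2:
  fixes AFFINE :: "'v analysis"
  assumes "affine_analysis AFFINE"
  shows "closed_family AFFINE linear_gaussian_states"
  unfolding closed_family_def
proof (intro conjI ballI impI)
  show "linear_gaussian_states \<subseteq> Collect (symbolic_state :: 'v state \<Rightarrow> bool)"
    unfolding linear_gaussian_states_def by blast
next
  fix g :: "'v state" and X1 X2
  assume g: "g \<in> linear_gaussian_states" and X: "X1 \<in> fmdom' g" "X2 \<in> fmdom' g"
    and parent: "X1 \<in> parents g X2" and can: "can_swap X1 X2 g"
  obtain \<mu>0 v0 where X1: "fmlookup g X1 = Some (Normal \<mu>0 v0)" "rv_free v0" "affine_expr \<mu>0"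
    "X1 \<notin> expr_vars \<mu>0" "expr_vars \<mu>0 \<subseteq> fmdom' g"
    using linear_gaussian_statesE[OF g X(1)] by blast
  obtain \<mu> v where X2: "fmlookup g X2 = Some (Normal \<mu> v)" "rv_free v" "affine_expr \<mu>"
    "X2 \<notin> expr_vars \<mu>" "expr_vars \<mu> \<subseteq> fmdom' g"
    using linear_gaussian_statesE[OF g X(2)] by blast
  have pa: "parents g X1 = expr_vars \<mu>0" "parents g X2 = expr_vars \<mu>"
    using X1 X2 by (simp_all add: parents_Normal)
  have neq: "X1 \<noteq> X2"
    using parent X2(4) unfolding pa by blast
  obtain a b where ab: "AFFINE \<mu> X1 = Some (a, b)" "rv_free a" "affine_expr b"
    "expr_vars b \<subseteq> expr_vars \<mu> - {X1}"
    using affine_analysisE[OF assms X2(3)] .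
  \<comment> \<open>These are the expressions built by the Gaussian case of \<open>swap\<close>;
    \<open>\<mu>1\<close> is the new mean of \<open>X1\<close>, with the intermediate
    \<open>\<mu>0''\<close> inlined.\<close>
  define \<mu>0' where "\<mu>0' = (a *\<^sub>e \<mu>0) +\<^sub>e b"
  define v0' where "v0' = (a *\<^sub>e a) *\<^sub>e v0"
  define v0'' where "v0'' = IntC 1 /\<^sub>e ((IntC 1 /\<^sub>e v0') +\<^sub>e (IntC 1 /\<^sub>e v))"
  define \<mu>1 where "\<mu>1 = (((\<mu>0' /\<^sub>e v0') +\<^sub>e (Var X2 /\<^sub>e v)) *\<^sub>e v0'' -\<^sub>e b) /\<^sub>e a"
  let ?g' = "fmupd X2 (Normal \<mu>0' (v0' +\<^sub>e v)) (fmupd X1 (Normal \<mu>1 (v0'' /\<^sub>e (a *\<^sub>e a))) g)"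
  \<comment> \<open>The Gaussian case applies and returns \<open>True\<close>: both variances are
    variable-free, and the analysis succeeds because \<open>\<mu>\<close> is affine.\<close>
  have swap: "swap AFFINE X1 X2 g = (?g', True)"
    using X1 X2 ab
    by (simp add: swap_def Let_def \<mu>1_def v0''_def v0'_def \<mu>0'_def)
  have rv_free: "rv_free v0'" "rv_free v0''"
    using ab X1 X2 by (simp_all add: v0''_def v0'_def)
  have vars: "expr_vars \<mu>0' = expr_vars \<mu>0 \<union> expr_vars b"
    "expr_vars \<mu>1 = expr_vars \<mu>0 \<union> expr_vars b \<union> {X2}"
    using rv_free ab X2 by (auto simp: \<mu>0'_def \<mu>1_def)
  have "?g' \<in> linear_gaussian_states"
  proof (rule linear_gaussian_update2[OF g X neq])
    show "rv_free (v0'' /\<^sub>e (a *\<^sub>e a))" "rv_free (v0' +\<^sub>e v)"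
      using rv_free ab X2 by simp_all
    show "affine_expr \<mu>0'"
      unfolding \<mu>0'_def by (intro affine_expr.add affine_expr.mul_left ab X1)
    \<comment> \<open>Affinity is syntactic: \<open>affine_expr.div\<close> asks only for a
      variable-free divisor, so division by \<open>a\<close> is covered even if its value is
      0.\<close>
    then show "affine_expr \<mu>1"
      unfolding \<mu>1_def
      by (intro affine_expr.div affine_expr.sub affine_expr.mul_right affine_expr.add
          affine_expr.var ab rv_free X2)
    show "expr_vars \<mu>1 \<subseteq> fmdom' g" "expr_vars \<mu>0' \<subseteq> fmdom' g"
      using X X1 X2 ab unfolding vars by blast+
    \<comment> \<open>The variables of \<open>b\<close> lie in those of \<open>\<mu>\<close> without
      \<open>X1\<close>, and \<open>X1\<close> does not occur in \<open>\<mu>0\<close>. Hence both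
      new parent sets lie in those prescribed by \<open>can_swap\<close>, possibly strictly, since
      \<open>b\<close> may lack further variables of \<open>\<mu>\<close>.\<close>
    show "acyclic_parents ((parents g)(X2 := expr_vars \<mu>0', X1 := expr_vars \<mu>1))"
      using can[unfolded can_swap_def pa] X1(4) ab(4) unfolding vars
      by (rule_tac acyclic_parents_mono) (auto simp: neq[symmetric])
  qed
  with swap show "\<exists>g' \<in> linear_gaussian_states. swap AFFINE X1 X2 g = (g', True)"
    by blast
qed

end
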